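(* For every nonnegative integer $k$, $\Delta(6k+3,k) < 0$.
   Context: For integers $n \ge 1$ and $k \ge 0$, $JL_{n,k} = \sum_{i=k}^{\lfloor n/2 \rfloor} \frac{n}{n-i} \binom{n-i}{i} \binom{i}{k}$ (empty sum $=0$), and $\Delta(n,k) = JL_{n,k+1} - JL_{n,k}$. *)

theory Defs
  imports Complex_Main
begin

(* Meant for n >= 1.  The natural-number subtraction n - i is never truncated and
   nonzero in the summation range i <= n div 2.  For k > n div 2 the index set is
   empty and the sum is 0. *)
definition JL :: "nat \<Rightarrow> nat \<Rightarrow> real" where
  "JL n k = (\<Sum>i = k..n div 2.
     real n / real (n - i) * real ((n - i) choose i) * real (i choose k))"

definition JL_Delta :: "nat \<Rightarrow> nat \<Rightarrow> real" where
  "JL_Delta n k = JL n (k + 1) - JL n k"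

end

theory Submission
  imports Defs
begin

text \<open>
  The numbers \<open>JF n k\<close> below are the coefficients of \<open>t^(n - 2 k)\<close> in \<open>(1 - t - t^2)^(-(k + 1))\<close>,
  and \<open>(k + 1) JL_{n, k+1} = n JF (n - 2) k\<close>. This turns the claim for \<open>k > 0\<close> into the bound
  \<open>(2 k + 1) JF (6 k + 1) k < (k + 1) JF (6 k + 2) k\<close>, which is proved by induction on \<open>k\<close>.
  The map taking the pair \<open>(JF (6 k + 1) k, JF (6 k + 2) k)\<close> to the next one is linear with
  coefficients rational in \<open>k\<close>; in terms of the defect
  \<open>u k = (k + 1) JF (6 k + 2) k - (2 k + 1) JF (6 k + 1) k\<close> it gives
  \<open>u (k + 1) = P k * u k + Q k * JF (6 k + 1) k\<close> with \<open>P k, Q k > 0\<close>.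
\<close>

definition JF :: "nat \<Rightarrow> nat \<Rightarrow> real" where
  "JF n k = (\<Sum>i\<le>n. real ((n - i) choose i) * real (i choose k))"

text \<open>The term \<open>i = 0\<close> is split off, the top term vanishes, and Pascal's rule is
  applied to the first binomial. The first half of the remaining sum then matches
  \<open>JF_Suc_shift\<close>; Pascal's rule on \<open>Suc i choose k\<close> resolves the second
  half.\<close>

lemma JF_rec_aux:
  "JF (n + 2) k = (if k = 0 then 1 else 0) +
     (\<Sum>i\<le>n. (real ((n - i) choose Suc i) + real ((n - i) choose i)) * real (Suc i choose k))"
proof -
  have "JF (n + 2) k = real (0 choose k) +
      (\<Sum>i\<le>Suc n. real ((Suc n - i) choose Suc i) * real (Suc i choose k))"
    unfolding JF_def by (simp only: add_2_eq_Suc' sum.atMost_Suc_shift) simp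
  also have "\<dots> = real (0 choose k) +
      (\<Sum>i\<le>n. real ((Suc n - i) choose Suc i) * real (Suc i choose k))"
    by simp
  also have "(\<Sum>i\<le>n. real ((Suc n - i) choose Suc i) * real (Suc i choose k)) =
      (\<Sum>i\<le>n. (real ((n - i) choose Suc i) + real ((n - i) choose i)) * real (Suc i choose k))"
    by (intro sum.cong) (auto simp: Suc_diff_le)
  finally show ?thesis
    by (cases k) auto
qed

lemma JF_Suc_shift:
  "JF (n + 1) k = (if k = 0 then 1 else 0) +
     (\<Sum>i\<le>n. real ((n - i) choose Suc i) * real (Suc i choose k))"
  unfolding JF_def by (simp only: Suc_eq_plus1[symmetric] sum.atMost_Suc_shift) (cases k; simp)

lemma JF_rec_0: "JF (n + 2) 0 = JF (n + 1) 0 + JF n 0"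
  by (simp only: JF_rec_aux JF_Suc_shift) (simp add: JF_def sum.distrib algebra_simps)

text \<open>Coefficientwise form of \<open>D * D^(-(k + 2)) = D^(-(k + 1))\<close> with
  \<open>D = 1 - t - t^2\<close>.\<close>

lemma JF_rec: "JF (n + 2) (k + 1) = JF (n + 1) (k + 1) + JF n (k + 1) + JF n k"
  by (simp only: JF_rec_aux JF_Suc_shift) (simp add: JF_def sum.distrib algebra_simps)

text \<open>
  This is \<open>d/dt D^(-(k + 1)) = (k + 1) (1 + 2 t) D^(-(k + 2))\<close> for \<open>D = 1 - t - t^2\<close>,
  read off coefficientwise.
\<close>
lemma JF_deriv:
  "(real n - 2 * real k) * JF n k = (real k + 1) * (JF (n + 1) (k + 1) + 2 * JF n (k + 1))"
proof (induction n arbitrary: k rule: induct_nat_012)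
  case 0
  show ?case by (cases k) (auto simp: JF_def)
next
  case 1
  show ?case
    by (cases k; cases "k - 1") (auto simp: JF_def numeral_2_eq_2)
next
  case (ge2 n)
  note rec = JF_rec[of "n + 1" k] JF_rec[of n k]
  show ?case
  proof (cases k)
    case 0
    with ge2(1)[of 0] ge2(2)[of 0] rec JF_rec_0[of n] show ?thesis
      by (simp add: algebra_simps numeral_eq_Suc)
  next
    case (Suc l)
    have r1: "JF (n + 2) k = JF (n + 1) k + JF n k + JF n l"
      using JF_rec[of n l] Suc by simp
    have r2: "JF (n + 3) (k + 1) = JF (n + 2) (k + 1) + JF (n + 1) (k + 1) + JF (n + 1) k"
      using JF_rec[of "n + 1" k] by (simp add: numeral_eq_Suc)
    have r3: "JF (n + 2) (k + 1) = JF (n + 1) (k + 1) + JF n (k + 1) + JF n k"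
      by (rule JF_rec)
    have i1: "(real n - 2 * real k) * JF n k = (real k + 1) * (JF (n + 1) (k + 1) + 2 * JF n (k + 1))"
      using ge2(1)[of k] by simp
    have i2: "(real n + 1 - 2 * real k) * JF (n + 1) k =
        (real k + 1) * (JF (n + 2) (k + 1) + 2 * JF (n + 1) (k + 1))"
      using ge2(2)[of k] by (simp add: add.commute)
    \<comment> \<open>Hypothesis one level lower, at \<open>l = k - 1\<close>, for the last term of
      \<open>r1\<close>; this is why \<open>k\<close> is arbitrary in the induction.\<close>
    have i3: "(real n + 2 - 2 * real k) * JF n l = real k * (JF (n + 1) k + 2 * JF n k)"
      using ge2(1)[of l] Suc by (simp add: algebra_simps)
    have "(real n + 2 - 2 * real k) * JF (n + 2) k =
        (real k + 1) * (JF (n + 3) (k + 1) + 2 * JF (n + 2) (k + 1))"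
      using r1 r2 r3 i1 i2 i3 by algebra
    then show ?thesis
      by (simp add: numeral_eq_Suc algebra_simps)
  qed
qed

text \<open>This encodes \<open>D F' = (k + 1) (1 + 2 t) F\<close> for
  \<open>F = D^(-(k + 1))\<close>. Subtracting the instances of \<open>JF_deriv\<close> at
  \<open>n + 1\<close> and \<open>n\<close> from the one at \<open>n + 2\<close> removes level
  \<open>k + 1\<close> by \<open>JF_rec\<close>.\<close>

lemma JF_rec_fixed:
  "(real n + 2 - 2 * real k) * JF (n + 2) k =
     (real n + 2 - real k) * JF (n + 1) k + (real n + 2) * JF n k"
proof -
  have "(real n - 2 * real k) * JF n k = (real k + 1) * (JF (n + 1) (k + 1) + 2 * JF n (k + 1))"
    by (rule JF_deriv)
  moreover have "(real n + 1 - 2 * real k) * JF (n + 1) k =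
      (real k + 1) * (JF (n + 2) (k + 1) + 2 * JF (n + 1) (k + 1))"
    using JF_deriv[of "n + 1" k] by (simp add: add.commute)
  moreover have "(real n + 2 - 2 * real k) * JF (n + 2) k =
      (real k + 1) * (JF (n + 3) (k + 1) + 2 * JF (n + 2) (k + 1))"
    using JF_deriv[of "n + 2" k] by (simp add: add.commute numeral_eq_Suc)
  moreover have "JF (n + 3) (k + 1) = JF (n + 2) (k + 1) + JF (n + 1) (k + 1) + JF (n + 1) k"
    using JF_rec[of "n + 1" k] by (simp add: numeral_eq_Suc)
  moreover have "JF (n + 2) (k + 1) = JF (n + 1) (k + 1) + JF n (k + 1) + JF n k"
    by (rule JF_rec)
  ultimately show ?thesis by algebra
qed

text \<open>Three times \<open>JF_deriv\<close> at \<open>n\<close> minus \<open>JF_deriv\<close> at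
  \<open>n + 1\<close> isolates one value at level \<open>k + 1\<close>. The factor 5 reflects
  \<open>(1 + 2 t)^2 + 4 D = 5\<close>.\<close>

lemma JF_raise:
  "5 * (real k + 1) * JF n (k + 1) =
     (3 * real n - 5 * real k + 1) * JF n k - (real n + 1 - 2 * real k) * JF (n + 1) k"
proof -
  have "(real n - 2 * real k) * JF n k = (real k + 1) * (JF (n + 1) (k + 1) + 2 * JF n (k + 1))"
    by (rule JF_deriv)
  moreover have "(real n + 1 - 2 * real k) * JF (n + 1) k =
      (real k + 1) * (JF (n + 2) (k + 1) + 2 * JF (n + 1) (k + 1))"
    using JF_deriv[of "n + 1" k] by (simp add: add.commute)
  moreover have "JF (n + 2) (k + 1) = JF (n + 1) (k + 1) + JF n (k + 1) + JF n k"
    by (rule JF_rec)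
  ultimately show ?thesis by algebra
qed

lemma JF_pos: "JF (6 * k + 1) k > 0"
proof -
  have "0 < real ((6 * k + 1 - k) choose k) * real (k choose k)"
    by simp
  also have "\<dots> \<le> JF (6 * k + 1) k"
    unfolding JF_def by (rule member_le_sum) auto
  finally show ?thesis .
qed

text \<open>At fixed level \<open>k\<close>, \<open>JF_rec_fixed\<close> carries \<open>x, y\<close>
  to the indices \<open>6 * k + 7\<close> and \<open>6 * k + 8\<close>; \<open>JF_raise\<close> and
  \<open>JF_deriv\<close> then lift the result to level \<open>k + 1\<close>.\<close>

lemma JF_step:
  fixes k :: nat
  defines "K \<equiv> real k"
  defines "x \<equiv> JF (6 * k + 1) k" and "y \<equiv> JF (6 * k + 2) k"
  assumes "(2 * K + 1) * x < (K + 1) * y"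
  shows "(2 * K + 3) * JF (6 * k + 7) (k + 1) < (K + 2) * JF (6 * k + 8) (k + 1)"
proof -
  define g where "g i = JF (6 * k + i) k" for i
  have K: "K \<ge> 0" and x: "x > 0"
    using JF_pos[of k] by (auto simp: K_def x_def)
  have rec: "(4 * K + real i + 2) * g (i + 2) =
      (5 * K + real i + 2) * g (i + 1) + (6 * K + real i + 2) * g i" for i
    using JF_rec_fixed[of "6 * k + i" k] by (simp add: g_def K_def algebra_simps)
  have g1: "g 1 = x" and g2: "g 2 = y"
    by (simp_all add: g_def x_def y_def)
  have r3: "(4*K + 3) * g 3 = (5*K + 3) * y + (6*K + 3) * x"
    using rec[of 1] g1 g2 by (simp add: numeral_eq_Suc algebra_simps)
  have r4: "(4*K + 4) * g 4 = (5*K + 4) * g 3 + (6*K + 4) * y"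
    using rec[of 2] g2 by (simp add: numeral_eq_Suc algebra_simps)
  have r5: "(4*K + 5) * g 5 = (5*K + 5) * g 4 + (6*K + 5) * g 3"
    using rec[of 3] by (simp add: numeral_eq_Suc algebra_simps)
  have r6: "(4*K + 6) * g 6 = (5*K + 6) * g 5 + (6*K + 6) * g 4"
    using rec[of 4] by (simp add: numeral_eq_Suc algebra_simps)
  have r7: "(4*K + 7) * g 7 = (5*K + 7) * g 6 + (6*K + 7) * g 5"
    using rec[of 5] by (simp add: numeral_eq_Suc algebra_simps)
  have r8: "(4*K + 8) * g 8 = (5*K + 8) * g 7 + (6*K + 8) * g 6"
    using rec[of 6] by (simp add: numeral_eq_Suc algebra_simps)

  \<comment> \<open>Products of the leading coefficients in \<open>r3\<close> to \<open>r7\<close>;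
    they clear denominators, so \<open>g 4\<close> to \<open>g 7\<close> become linear forms in
    \<open>x, y\<close> with polynomial coefficients.\<close>
  define D4 where "D4 = (4*K + 3) * (4*K + 4)"
  define D5 where "D5 = D4 * (4*K + 5)"
  define D6 where "D6 = D5 * (4*K + 6)"
  define D7 where "D7 = D6 * (4*K + 7)"
  have D7: "D7 > 0"
    using K by (simp add: D7_def D6_def D5_def D4_def)
  have e4: "D4 * g 4 = (24 + 69*K + 49*K^2) * y + (12 + 39*K + 30*K^2) * x"
    unfolding D4_def using r3 r4 by algebra
  have e5: "D5 * g 5 = (180 + 697*K + 882*K^2 + 365*K^3) * y
      + (120 + 507*K + 681*K^2 + 294*K^3) * x"
  proof -
    have "D5 * g 5 = (5*K + 5) * (D4 * g 4) + (6*K + 5) * (4*K + 4) * ((4*K + 3) * g 3)"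
      unfolding D5_def D4_def using r5 by algebra
    then show ?thesis unfolding e4 r3 by algebra
  qed
  have e6: "D6 * g 6 = (1800 + 8448*K + 14549*K^2 + 10902*K^3 + 3001*K^4) * y
      + (1080 + 5460*K + 9915*K^2 + 7725*K^3 + 2190*K^4) * x"
  proof -
    have "D6 * g 6 = (5*K + 6) * (D5 * g 5) + (6*K + 6) * (4*K + 5) * (D4 * g 4)"
      unfolding D6_def D5_def using r6 by algebra
    then show ?thesis unfolding e5 e4 by algebra
  qed
  have e7: "D7 * g 7 = (20160 + 108930*K + 230055*K^2 + 237565*K^3 + 120045*K^4 + 23765*K^5) * y
      + (12600 + 72594*K + 160635*K^2 + 171750*K^3 + 89115*K^4 + 18006*K^5) * x"
  proof -
    have "D7 * g 7 = (5*K + 7) * (D6 * g 6) + (6*K + 7) * (4*K + 6) * (D5 * g 5)"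
      unfolding D7_def D6_def using r7 by algebra
    then show ?thesis unfolding e6 e5 by algebra
  qed
  define u where "u = (K + 1) * y - (2*K + 1) * x"
  \<comment> \<open>\<open>P\<close> is the coefficient of \<open>y\<close> in the combination
    below, whose coefficient of \<open>x\<close> has leading term \<open>-1458*K^6\<close>.
    Multiplying by \<open>K + 1\<close> and replacing \<open>(K + 1) * y\<close> by
    \<open>u + (2*K + 1) * x\<close> gives \<open>Q\<close>, where all coefficients are
    positive.\<close>
  define P where "P = 20160 + 110088*K + 236086*K^2 + 249465*K^3 + 131105*K^4 + 28527*K^5 + 729*K^6"
  define Q where "Q = 30240 + 217992*K + 638644*K^2 + 974960*K^3 + 819020*K^4 + 359368*K^5 + 64416*K^6"
  have "P > 0" "Q > 0"
    using K by (auto simp: P_def Q_def intro!: add_pos_nonneg)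
  \<comment> \<open>Up to positive factors, this combination of \<open>g 7\<close> and
    \<open>g 8\<close> is the defect at level \<open>k + 1\<close>.\<close>
  have "D7 * ((4*K + 8) * g 8 - (8*K + 12) * g 7) =
      (5*K + 8 - (8*K + 12)) * (D7 * g 7) + (6*K + 8) * (4*K + 7) * (D6 * g 6)"
    unfolding D7_def using r8 by algebra
  then have "(K + 1) * (D7 * ((4*K + 8) * g 8 - (8*K + 12) * g 7)) = P * u + Q * x"
    unfolding e7 e6 P_def Q_def u_def by algebra
  also have "\<dots> > 0"
    using \<open>P > 0\<close> \<open>Q > 0\<close> x assms by (simp add: u_def add_pos_pos)
  finally have pos: "(4*K + 8) * g 8 - (8*K + 12) * g 7 > 0"
    using K D7 by (simp add: zero_less_mult_iff)

  define h7 h8 where "h7 = JF (6 * k + 7) (k + 1)" and "h8 = JF (6 * k + 8) (k + 1)"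
  have "5 * (K + 1) * h7 = (13*K + 22) * g 7 - (4*K + 8) * g 8"
    using JF_raise[of k "6 * k + 7"] by (simp add: h7_def g_def K_def algebra_simps)
  moreover have "(4*K + 7) * g 7 = (K + 1) * (h8 + 2 * h7)"
    using JF_deriv[of "6 * k + 7" k] by (simp add: h7_def h8_def g_def K_def algebra_simps)
  ultimately have "5 * (K + 1) * ((K + 2) * h8 - (2*K + 3) * h7) =
      (4*K + 7) * ((4*K + 8) * g 8 - (8*K + 12) * g 7)"
    by algebra
  also have "\<dots> > 0"
    using pos K by simp
  finally show ?thesis
    using K by (simp add: zero_less_mult_iff h7_def h8_def)
qed

lemma JF_bound: "(2 * real k + 1) * JF (6 * k + 1) k < (real k + 1) * JF (6 * k + 2) k"
proof (induction k)
  case 0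
  show ?case by (simp add: JF_def numeral_2_eq_2)
next
  case (Suc k)
  from JF_step[OF Suc] show ?case
    by (simp add: algebra_simps numeral_eq_Suc)
qed

text \<open>Absorption is used twice: \<open>k + 1\<close> turns \<open>Suc i choose (k + 1)\<close>
  into \<open>Suc i\<close> times \<open>i choose k\<close>, and that \<open>Suc i\<close> is
  absorbed by the other binomial, producing the factor that cancels the denominator.\<close>

lemma JL_eq_JF: "(real k + 1) * JL (n + 2) (k + 1) = (real n + 2) * JF n k"
proof -
  \<comment> \<open>The added terms vanish: below the old range by the second binomial, above it by
    the first. Stopping at \<open>Suc n\<close> keeps the denominators nonzero.\<close>
  have "JL (n + 2) (k + 1) = (\<Sum>i = Suc 0..Suc n.
     real (n + 2) / real (n + 2 - i) * real ((n + 2 - i) choose i) * real (i choose (k + 1)))"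
    unfolding JL_def by (rule sum.mono_neutral_left) (auto simp: binomial_eq_0_iff)
  also have "\<dots> = (\<Sum>i\<le>n.
     real (n + 2) / real (Suc n - i) * real ((Suc n - i) choose Suc i) * real (Suc i choose (k + 1)))"
    by (subst sum.atLeast_Suc_atMost_Suc_shift) (simp add: atMost_atLeast0)
  finally have "(real k + 1) * JL (n + 2) (k + 1) = (\<Sum>i\<le>n. (real k + 1) *
     (real (n + 2) / real (Suc n - i) * real ((Suc n - i) choose Suc i) * real (Suc i choose (k + 1))))"
    by (simp add: sum_distrib_left)
  also have "\<dots> = (\<Sum>i\<le>n. (real n + 2) * (real ((n - i) choose i) * real (i choose k)))"
  proof (rule sum.cong)
    fix i assume "i \<in> {..n}"
    then have d: "Suc n - i = Suc (n - i)" by (simp add: Suc_diff_le)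
    have a: "real (Suc k) * real (Suc i choose Suc k) = real (Suc i) * real (i choose k)"
      unfolding of_nat_mult[symmetric] by (simp only: Suc_times_binomial_eq mult.commute)
    have b: "real (Suc i) * real (Suc (n - i) choose Suc i) = real (Suc (n - i)) * real ((n - i) choose i)"
      unfolding of_nat_mult[symmetric] by (simp only: Suc_times_binomial_eq mult.commute)
    have "(real k + 1) * (real (n + 2) / real (Suc n - i) * real ((Suc n - i) choose Suc i) *
        real (Suc i choose (k + 1))) =
        real (n + 2) / real (Suc (n - i)) * real (Suc (n - i) choose Suc i) *
        (real (Suc k) * real (Suc i choose Suc k))"
      by (simp only: d) (simp add: add.commute mult_ac)
    also have "\<dots> = real (n + 2) / real (Suc (n - i)) *
        (real (Suc i) * real (Suc (n - i) choose Suc i)) * real (i choose k)"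
      unfolding a by (simp only: mult_ac)
    also have "\<dots> = (real n + 2) * (real ((n - i) choose i) * real (i choose k))"
      unfolding b by (simp del: of_nat_Suc add: field_simps) (simp add: algebra_simps)
    finally show "(real k + 1) * (real (n + 2) / real (Suc n - i) *
        real ((Suc n - i) choose Suc i) * real (Suc i choose (k + 1))) =
        (real n + 2) * (real ((n - i) choose i) * real (i choose k))" .
  qed simp
  finally show ?thesis
    by (simp add: JF_def sum_distrib_left)
qed

theorem theorem3p7:
  fixes k :: nat
  shows "JL_Delta (6 * k + 3) k < 0"
proof (cases k)
  \<comment> \<open>\<open>JL_eq_JF\<close> does not reach \<open>JL n 0\<close>, so this case is
    computed directly: \<open>3 - 4 < 0\<close>.\<close>
  case 0
  have "{0..Suc 0} = {0, Suc 0}" and "(3::nat) div 2 = Suc 0" by auto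
  with 0 show ?thesis by (simp add: JL_Delta_def JL_def)
next
  case (Suc l)
  define n where "n = 6 * k + 1"
  define K where "K = real k"
  have K: "K > 0" using Suc by (simp add: K_def)
  have n: "6 * k + 3 = n + 2" "real n = 6 * K + 1" by (simp_all add: n_def K_def)
  have a: "(K + 1) * JL (n + 2) (k + 1) = (6 * K + 3) * JF n k"
    using JL_eq_JF[of k n] n by (simp add: K_def)
  have b: "K * JL (n + 2) k = (6 * K + 3) * JF n l"
    using JL_eq_JF[of l n] n Suc by (simp add: K_def add.commute)
  \<comment> \<open>Moves the level \<open>l = k - 1\<close> value up to level \<open>k\<close>, so
    that both \<open>JL\<close> terms are expressed by the pair in \<open>JF_bound\<close>.\<close>
  have c: "(4 * K + 3) * JF n l = K * (JF (n + 1) k + 2 * JF n k)"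
    using JF_deriv[of n l] n Suc by (simp add: K_def algebra_simps)
  have d: "(2 * K + 1) * JF n k < (K + 1) * JF (n + 1) k"
    using JF_bound[of k] by (simp add: K_def n_def)
  have "(4 * K + 3) * (K + 1) * K * (JL (n + 2) (k + 1) - JL (n + 2) k) =
      (6 * K + 3) * K * ((2 * K + 1) * JF n k - (K + 1) * JF (n + 1) k)"
    using a b c by algebra
  also have "\<dots> < 0"
    using d K by (simp add: mult_pos_neg)
  finally have "JL (n + 2) (k + 1) - JL (n + 2) k < 0"
    using K by (simp add: mult_less_0_iff)
  then show ?thesis
    by (simp only: JL_Delta_def n)
qed

end
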